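(* Let $H$ be a vertex-transitive graph and $n\in\mathbb{N}$. Then there exists a connected vertex-transitive graph $G$ and a root $R_G$ of $G$ with $|V(R_G)|=n$ such that $H$ is isomorphic to $Res(G,R_G)$.
   Context: A root of a connected finite graph $G$ is an induced subgraph $R_G=\langle V_0\rangle$ on a nonempty vertex set $V_0$; with $V_i$ the set of vertices at distance exactly $i$ from $V_0$ and $r$ the largest $i$ with $V_i\ne\emptyset$, the distance-residual graph is $Res(G,R_G)=\langle V_r\rangle$ (induced subgraph). *)

theory Defs
  imports "Graph_Theory.Graph_Theory"
begin

text \<open>
  Finite simple graphs are the symmetric, loop-free digraphs without parallel arcs of the
  locale \<^locale>\<open>graph\<close>.
\<close>

definition automorphism ::
    "('a, 'b) pre_digraph \<Rightarrow> ('a, 'b, 'a, 'b) digraph_isomorphism \<Rightarrow> bool" where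
  "automorphism G f \<longleftrightarrow> pre_digraph.digraph_isomorphism G f \<and> app_iso f G = G"

definition vertex_transitive :: "('a, 'b) pre_digraph \<Rightarrow> bool" where
  "vertex_transitive G \<longleftrightarrow>
     (\<forall>u \<in> verts G. \<forall>v \<in> verts G. \<exists>f. automorphism G f \<and> iso_verts f u = v)"

definition graph_dist :: "('a, 'b) pre_digraph \<Rightarrow> 'a \<Rightarrow> 'a \<Rightarrow> ereal" where
  "graph_dist G u v = wf_digraph.\<mu> G (\<lambda>_. 1) u v"

definition graph_set_dist :: "('a, 'b) pre_digraph \<Rightarrow> 'a set \<Rightarrow> 'a \<Rightarrow> ereal" where
  "graph_set_dist G S v = (INF u \<in> S. graph_dist G u v)"

definition graph_root :: "('a, 'b) pre_digraph \<Rightarrow> ('a, 'b) pre_digraph \<Rightarrow> bool" where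
  "graph_root G R \<longleftrightarrow> induced_subgraph R G \<and> verts R \<noteq> {}"

definition dist_layer :: "('a, 'b) pre_digraph \<Rightarrow> 'a set \<Rightarrow> nat \<Rightarrow> 'a set" where
  "dist_layer G S i = {v \<in> verts G. graph_set_dist G S v = ereal (real i)}"

definition max_dist :: "('a, 'b) pre_digraph \<Rightarrow> 'a set \<Rightarrow> nat" where
  "max_dist G S = Max {i. dist_layer G S i \<noteq> {}}"

definition distance_residual ::
    "('a, 'b) pre_digraph \<Rightarrow> ('a, 'b) pre_digraph \<Rightarrow> ('a, 'b) pre_digraph" where
  "distance_residual G R = G \<restriction> dist_layer G (verts R) (max_dist G (verts R))"

end

theory Submission
  imports Defs "HOL-Number_Theory.Cong"
begin

text \<open>
  Take \<open>G\<close> to be the lexicographic product of the cycle of length \<open>n + 5\<close> with \<open>H\<close>, that is, the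
  cycle with every vertex blown up to a copy of \<open>H\<close>, and let the root consist of one vertex from
  each of \<open>n\<close> consecutive fibres. Any vertex lies within distance 2 of every vertex of its own
  fibre, so all fibres at cyclic distance at most 2 from the root arc are within distance 2 of the
  root; the only remaining fibre is the one opposite the arc. It is at distance 3 and induces \<open>H\<close>.
\<close>

section \<open>Graphs given by a relation on a set and an injective coding of its elements\<close>

definition coded_graph :: "('x \<Rightarrow> 'c) \<Rightarrow> 'x set \<Rightarrow> ('x \<Rightarrow> 'x \<Rightarrow> bool) \<Rightarrow> ('c, 'c \<times> 'c) pre_digraph" where
  "coded_graph c X A =
     \<lparr>verts = c ` X, arcs = {(c x, c y) | x y. x \<in> X \<and> y \<in> X \<and> A x y}, tail = fst, head = snd\<rparr>"

lemma coded_graph_simps [simp]: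
  "verts (coded_graph c X A) = c ` X"
  "arcs (coded_graph c X A) = {(c x, c y) | x y. x \<in> X \<and> y \<in> X \<and> A x y}"
  "tail (coded_graph c X A) = fst"
  "head (coded_graph c X A) = snd"
  by (simp_all add: coded_graph_def)

lemma wf_digraph_coded_graph: "wf_digraph (coded_graph c X A)"
  by unfold_locales auto

lemma graph_coded_graph:
  assumes "finite X" "inj_on c X"
    and "\<And>x y. \<lbrakk>x \<in> X; y \<in> X; A x y\<rbrakk> \<Longrightarrow> A y x" and "\<And>x. x \<in> X \<Longrightarrow> \<not> A x x"
  shows "graph (coded_graph c X A)"
proof -
  have "{(c x, c y) | x y. x \<in> X \<and> y \<in> X \<and> A x y} \<subseteq> c ` X \<times> c ` X"
    by auto
  then have "finite {(c x, c y) | x y. x \<in> X \<and> y \<in> X \<and> A x y}"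
    by (rule finite_subset) (simp add: assms(1))
  moreover have "symmetric (coded_graph c X A)"
    unfolding symmetric_conv using assms(3) by fastforce
  ultimately show ?thesis
    using assms(1,2,4) by unfold_locales (auto simp: arc_to_ends_def inj_on_eq_iff)
qed

lemma coded_graph_adj:
  assumes "x \<in> X" "y \<in> X" "A x y"
  shows "c x \<rightarrow>\<^bsub>coded_graph c X A\<^esub> c y"
  using assms by (force simp: arcs_ends_conv)

lemma coded_graph_induce:
  assumes "inj_on c X" "Y \<subseteq> X"
  shows "coded_graph c X A \<restriction> (c ` Y) = coded_graph c Y A"
proof (rule pre_digraph.equality)
  show "arcs (coded_graph c X A \<restriction> (c ` Y)) = arcs (coded_graph c Y A)"
  proof (intro equalityI subsetI)
    fix a assume "a \<in> arcs (coded_graph c X A \<restriction> (c ` Y))"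
    then obtain x y where xy: "x \<in> X" "y \<in> X" "A x y" "a = (c x, c y)" "c x \<in> c ` Y" "c y \<in> c ` Y"
      by auto
    then have "x \<in> Y" "y \<in> Y"
      using assms inj_on_image_mem_iff by metis+
    then show "a \<in> arcs (coded_graph c Y A)"
      using xy by auto
  qed (use assms(2) in auto)
qed (auto simp: induce_subgraph_def)

text \<open>Without parallel arcs an arc of \<open>H\<close> is determined by its ends. A bijection
  on vertices that respects adjacency therefore extends to arcs, sending each arc to the pair of
  images of its ends.\<close>

lemma digraph_iso_coded_graph:
  assumes "nomulti_digraph H" "inj_on c Y" "bij_betw p (verts H) Y"
    and adj: "\<And>u v. \<lbrakk>u \<in> verts H; v \<in> verts H\<rbrakk> \<Longrightarrow> u \<rightarrow>\<^bsub>H\<^esub> v \<longleftrightarrow> A (p u) (p v)"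
  shows "digraph_iso H (coded_graph c Y A)"
proof -
  interpret nomulti_digraph H by fact
  let ?f = "\<lparr>iso_verts = \<lambda>u. c (p u), iso_arcs = \<lambda>a. (c (p (tail H a)), c (p (head H a))),
    iso_head = snd, iso_tail = fst\<rparr>"
  have inj: "inj_on (\<lambda>u. c (p u)) (verts H)"
    using comp_inj_on[of p "verts H" c] assms(2,3) by (simp add: bij_betw_def comp_def)
  have im: "p ` verts H = Y"
    using assms(3) by (simp add: bij_betw_def)
  have "digraph_isomorphism ?f"
    unfolding digraph_isomorphism_def using inj wf_digraph
    by (auto simp: inj_on_def arc_to_ends_def intro!: no_multi_arcs)
  moreover have "coded_graph c Y A = app_iso ?f H"
  proof (rule pre_digraph.equality)
    show "arcs (coded_graph c Y A) = arcs (app_iso ?f H)"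
    proof (intro equalityI subsetI)
      fix a assume "a \<in> arcs (coded_graph c Y A)"
      then obtain u v where uv: "u \<in> verts H" "v \<in> verts H" "A (p u) (p v)"
        and a: "a = (c (p u), c (p v))"
        using im by auto
      then have "u \<rightarrow>\<^bsub>H\<^esub> v" using adj by simp
      then show "a \<in> arcs (app_iso ?f H)"
        using a by (auto simp: arcs_ends_conv)
    next
      fix a assume "a \<in> arcs (app_iso ?f H)"
      then obtain b where b: "b \<in> arcs H" "a = (c (p (tail H b)), c (p (head H b)))"
        by auto
      then have "tail H b \<rightarrow>\<^bsub>H\<^esub> head H b"
        by (auto simp: arcs_ends_conv)
      then have "A (p (tail H b)) (p (head H b))"
        using adj b by simp
      then show "a \<in> arcs (coded_graph c Y A)"
        using b im[symmetric] by force
    qed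
  qed (use im in auto)
  ultimately show ?thesis
    unfolding digraph_iso_def by blast
qed

text \<open>Reduces transitivity to permutations of the uncoded set \<open>X\<close>. Since arcs are
  pairs of codes, a map of the vertices acts on arcs by applying it to both components.\<close>

lemma vertex_transitive_coded_graph:
  assumes inj: "inj_on c X"
    and trans: "\<And>x y. \<lbrakk>x \<in> X; y \<in> X\<rbrakk> \<Longrightarrow> \<exists>p. bij_betw p X X \<and> p x = y \<and>
      (\<forall>u\<in>X. \<forall>v\<in>X. A u v \<longleftrightarrow> A (p u) (p v))"
  shows "vertex_transitive (coded_graph c X A)"
  unfolding vertex_transitive_def
proof (intro ballI)
  let ?G = "coded_graph c X A"
  fix s t assume "s \<in> verts ?G" "t \<in> verts ?G"
  then obtain x y where xy: "x \<in> X" "y \<in> X" and st: "s = c x" "t = c y"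
    by auto
  obtain p where p: "bij_betw p X X" "p x = y"
    and adj: "\<And>u v. \<lbrakk>u \<in> X; v \<in> X\<rbrakk> \<Longrightarrow> A (p u) (p v) \<longleftrightarrow> A u v"
    using trans[OF xy] by metis
  \<comment> \<open>Conjugating \<open>p\<close> by the coding turns it into a map on codes.\<close>
  define g where "g = c \<circ> p \<circ> inv_into X c"
  have g [simp]: "g (c u) = c (p u)" if "u \<in> X" for u
    using that inj by (simp add: g_def)
  have px: "p u \<in> X" if "u \<in> X" for u
    using p(1) that by (auto simp: bij_betw_def)
  have im: "p ` X = X"
    using p(1) by (simp add: bij_betw_def)
  let ?f = "\<lparr>iso_verts = g, iso_arcs = map_prod g g, iso_head = snd, iso_tail = fst\<rparr>"
  have "inj_on g (c ` X)"
  proof (rule inj_onI)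
    fix s t assume "s \<in> c ` X" "t \<in> c ` X" and eq: "g s = g t"
    then obtain u v where uv: "u \<in> X" "v \<in> X" "s = c u" "t = c v"
      by blast
    then have "p u = p v"
      using eq inj px by (simp add: inj_on_eq_iff)
    then show "s = t"
      using uv bij_betw_imp_inj_on[OF p(1)] by (simp add: inj_on_eq_iff)
  qed
  moreover from this have "inj_on (map_prod g g) (arcs ?G)"
    by (auto intro: inj_on_subset[OF map_prod_inj_on])
  ultimately have "pre_digraph.digraph_isomorphism ?G ?f"
    unfolding pre_digraph.digraph_isomorphism_def using wf_digraph_coded_graph by auto
  moreover have "app_iso ?f ?G = ?G"
  proof (rule pre_digraph.equality)
    show "verts (app_iso ?f ?G) = verts ?G"
    proof -
      have "g ` c ` X = c ` p ` X"
        by (simp add: image_image)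
      then show ?thesis
        using im by simp
    qed
    show "arcs (app_iso ?f ?G) = arcs ?G"
    proof (intro equalityI subsetI)
      fix a assume "a \<in> arcs (app_iso ?f ?G)"
      then obtain u v where "u \<in> X" "v \<in> X" "A u v" "a = (c (p u), c (p v))"
        by auto
      then show "a \<in> arcs ?G"
        using adj[of u v] px unfolding coded_graph_simps by blast
    next
      \<comment> \<open>For this inclusion \<open>p\<close> has to be onto: both ends of the arc are
        images under \<open>p\<close>, and the adjacency pulls back to their preimages.\<close>
      fix a assume "a \<in> arcs ?G"
      then obtain u' v' where uv': "u' \<in> p ` X" "v' \<in> p ` X" "A u' v'" "a = (c u', c v')"
        unfolding coded_graph_simps im by blast
      then obtain u v where "u \<in> X" "v \<in> X" "A (p u) (p v)" "a = (c (p u), c (p v))"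
        by blast
      then have "(c u, c v) \<in> arcs ?G" "a = map_prod g g (c u, c v)"
        using adj by auto
      then show "a \<in> arcs (app_iso ?f ?G)"
        unfolding arcs_app_iso by (simp only: image_eqI digraph_isomorphism.simps)
    qed
  qed auto
  ultimately show "\<exists>f. automorphism ?G f \<and> iso_verts f s = t"
    unfolding automorphism_def using st xy p(2)
    by (intro exI[of _ ?f]) simp
qed

text \<open>Extracts the combinatorial content of an automorphism. It maps the set of end pairs of
  \<open>H\<close> onto itself, so it preserves adjacency; it also reflects adjacency, because
  injectivity on vertices identifies the preimage of a pair.\<close>

lemma vertex_transitiveE:
  assumes "vertex_transitive H" "u \<in> verts H" "v \<in> verts H"
  obtains p where "bij_betw p (verts H) (verts H)" "p u = v"
    "\<And>x y. \<lbrakk>x \<in> verts H; y \<in> verts H\<rbrakk> \<Longrightarrow> x \<rightarrow>\<^bsub>H\<^esub> y \<longleftrightarrow> p x \<rightarrow>\<^bsub>H\<^esub> p y"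
proof -
  obtain f where f: "pre_digraph.digraph_isomorphism H f" "app_iso f H = H" "iso_verts f u = v"
    using assms unfolding vertex_transitive_def automorphism_def by blast
  then interpret wf_digraph H
    by (simp add: pre_digraph.digraph_isomorphism_def)
  have inj: "inj_on (iso_verts f) (verts H)"
    using f(1) by (rule digraph_isomorphism_inj_on_verts)
  have "iso_verts f ` verts H = verts H"
    using f(2) by (metis verts_app_iso)
  then have "bij_betw (iso_verts f) (verts H) (verts H)"
    using inj by (simp add: bij_betw_def)
  moreover have "x \<rightarrow>\<^bsub>H\<^esub> y \<longleftrightarrow> iso_verts f x \<rightarrow>\<^bsub>H\<^esub> iso_verts f y"
    if xy: "x \<in> verts H" "y \<in> verts H" for x y
  proof -
    have "arcs_ends H = (\<lambda>(u,v). (iso_verts f u, iso_verts f v)) ` arcs_ends H"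
      using arcs_ends_app_iso_eq[OF f(1)] f(2) by simp
    then have "iso_verts f x \<rightarrow>\<^bsub>H\<^esub> iso_verts f y \<longleftrightarrow>
        (iso_verts f x, iso_verts f y) \<in> (\<lambda>(u,v). (iso_verts f u, iso_verts f v)) ` arcs_ends H"
      by (rule arg_cong)
    also have "\<dots> \<longleftrightarrow>
        (\<exists>e\<in>arcs_ends H. iso_verts f x = iso_verts f (fst e) \<and> iso_verts f y = iso_verts f (snd e))"
      by (auto simp: image_iff split_beta)
    also have "\<dots> \<longleftrightarrow> x \<rightarrow>\<^bsub>H\<^esub> y"
    proof
      assume "\<exists>e\<in>arcs_ends H. iso_verts f x = iso_verts f (fst e) \<and> iso_verts f y = iso_verts f (snd e)"
      then obtain x' y' where e: "x' \<rightarrow>\<^bsub>H\<^esub> y'"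
        "iso_verts f x = iso_verts f x'" "iso_verts f y = iso_verts f y'"
        by auto
      then have "x = x'" "y = y'"
        using xy adj_in_verts[OF e(1)] inj by (auto dest: inj_onD)
      then show "x \<rightarrow>\<^bsub>H\<^esub> y"
        using e(1) by simp
    qed force
    finally show ?thesis by simp
  qed
  ultimately show ?thesis
    using that f(3) by blast
qed

section \<open>Bounds on the distance from a set, and recognition of the last distance layer\<close>

context wf_digraph
begin

lemma graph_set_dist_le_length:
  assumes "awalk u p v" "u \<in> S"
  shows "graph_set_dist G S v \<le> ereal (real (length p))"
proof -
  have "awalk_cost (\<lambda>_. 1) p = real (length p)"
    by (induct p) auto
  then have "graph_dist G u v \<le> ereal (real (length p))"
    unfolding graph_dist_def using min_cost_le_walk_cost[OF assms(1), of "\<lambda>_. 1"] by simp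
  then show ?thesis
    unfolding graph_set_dist_def using assms(2) by (rule INF_lower2[rotated])
qed

text \<open>A potential that vanishes on \<open>S\<close> and rises by at most 1 along each arc
  cannot exceed the length of a walk from \<open>S\<close> to \<open>v\<close>. An unreachable
  \<open>v\<close> causes no trouble, since the infimum over no walks is infinite.\<close>

lemma graph_set_dist_ge_potential:
  fixes f :: "'a \<Rightarrow> nat"
  assumes "\<And>u. u \<in> S \<Longrightarrow> f u = 0"
    and lip: "\<And>a. a \<in> arcs G \<Longrightarrow> f (head G a) \<le> f (tail G a) + 1"
  shows "ereal (real (f v)) \<le> graph_set_dist G S v"
proof -
  have walk: "real (f v) \<le> real (f u) + awalk_cost (\<lambda>_. 1) p" if "awalk u p v" for u p
    using that
  proof (induct p arbitrary: u)
    case Nil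
    then show ?case by (simp add: awalk_Nil_iff)
  next
    case (Cons a p)
    then have a: "a \<in> arcs G" "u = tail G a" "awalk (head G a) p v"
      by (simp_all add: awalk_Cons_iff)
    have "real (f (head G a)) \<le> real (f u) + 1"
      using lip[OF a(1)] a(2) by simp
    then show ?case
      using Cons.hyps[OF a(3)] by simp
  qed
  show ?thesis
    unfolding graph_set_dist_def graph_dist_def \<mu>_def
  proof (intro INF_greatest)
    fix u p assume "u \<in> S" "p \<in> {p. awalk u p v}"
    then show "ereal (real (f v)) \<le> ereal (awalk_cost (\<lambda>_. 1) p)"
      using walk[of u p] assms(1)[of u] by simp
  qed
qed

end

lemma distance_residual_eq:
  assumes L: "dist_layer G (verts R) r = L" and "L \<noteq> {}"
    and le: "\<And>v. v \<in> verts G \<Longrightarrow> graph_set_dist G (verts R) v \<le> ereal (real r)"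
  shows "distance_residual G R = G \<restriction> L"
proof -
  have "i \<le> r" if i: "dist_layer G (verts R) i \<noteq> {}" for i
  proof -
    obtain v where "v \<in> verts G" "graph_set_dist G (verts R) v = ereal (real i)"
      using i by (auto simp: dist_layer_def)
    then show ?thesis
      using le[of v] by simp
  qed
  moreover have "dist_layer G (verts R) r \<noteq> {}"
    using assms by simp
  \<comment> \<open>The bound \<open>r\<close> also makes the set of occurring distances finite, so
    that its \<open>Max\<close> is meaningful.\<close>
  ultimately have "max_dist G (verts R) = r"
    unfolding max_dist_def by (intro Max_eqI) (auto simp: finite_nat_set_iff_bounded_le)
  then show ?thesis
    using L by (simp add: distance_residual_def)
qed

section \<open>The cycle: adjacency, distance from an arc, rotations\<close>

definition cyclic_adj :: "nat \<Rightarrow> nat \<Rightarrow> nat \<Rightarrow> bool" where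
  "cyclic_adj N i j \<longleftrightarrow> j = (i + 1) mod N \<or> i = (j + 1) mod N"

lemma cyclic_adj_sym: "cyclic_adj N i j \<longleftrightarrow> cyclic_adj N j i"
  by (auto simp: cyclic_adj_def)

text \<open>Removes \<open>mod\<close> in favour of linear arithmetic; the last two disjuncts are
  the edge that closes the cycle, in its two orientations.\<close>

lemma cyclic_adj_iff:
  assumes "i < N" "j < N"
  shows "cyclic_adj N i j \<longleftrightarrow>
    j = Suc i \<or> i = Suc j \<or> Suc i = N \<and> j = 0 \<or> Suc j = N \<and> i = 0"
  using assms by (auto simp: cyclic_adj_def mod_Suc)

text \<open>
  The distance of \<open>i\<close> from the arc \<open>{..<n}\<close> in the cycle of length \<open>n + 5\<close>; the truncated
  subtraction makes it 0 on the arc.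
\<close>

definition arc_dist :: "nat \<Rightarrow> nat \<Rightarrow> nat" where
  "arc_dist n i = min (i + 1 - n) (n + 5 - i)"

text \<open>Between successive indices each term of the minimum changes by at most 1. The closing
  edge joins \<open>n + 4\<close>, where the value is 1, to 0, where it is 0 because
  \<open>n \<ge> 1\<close> puts 0 on the arc.\<close>

lemma arc_dist_le:
  assumes "i < n + 5" "j < n + 5" "n \<ge> 1" "cyclic_adj (n + 5) i j"
  shows "arc_dist n j \<le> arc_dist n i + 1"
proof -
  consider "j = Suc i" | "i = Suc j" | "Suc i = n + 5" "j = 0" | "Suc j = n + 5" "i = 0"
    using assms cyclic_adj_iff by blast
  then show ?thesis
  proof cases
    case 4
    then have "n + 5 - j = 1" by simp
    then show ?thesis by (simp add: arc_dist_def)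
  next
    case 3
    then have "j + 1 - n = 0" using assms(3) by simp
    then show ?thesis by (simp add: arc_dist_def)
  qed (simp_all add: arc_dist_def min_le_iff_disj, linarith+)
qed

lemma mod_add_eq_cancel:
  fixes i j a N :: nat
  shows "(i + a) mod N = (j + a) mod N \<longleftrightarrow> i mod N = j mod N"
  using cong_add_rcancel_nat[of i a j N] by (simp add: cong_def)

text \<open>Rotation commutes with the successor modulo \<open>N\<close> and can be cancelled
  there.\<close>

lemma cyclic_adj_rotate:
  assumes "i < N" "j < N"
  shows "cyclic_adj N ((i + a) mod N) ((j + a) mod N) \<longleftrightarrow> cyclic_adj N i j"
proof -
  have "(l + a) mod N = ((k + a) mod N + 1) mod N \<longleftrightarrow> l = (k + 1) mod N" if "l < N" for k l
    using that mod_add_eq_cancel[of l a N "k + 1"] by (simp add: mod_Suc_eq)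
  then show ?thesis
    using assms by (simp add: cyclic_adj_def)
qed

lemma bij_betw_rotate:
  fixes a N :: nat
  shows "bij_betw (\<lambda>i. (i + a) mod N) {..<N} {..<N}"
proof -
  have "inj_on (\<lambda>i. (i + a) mod N) {..<N}"
    by (auto simp: inj_on_def mod_add_eq_cancel)
  moreover have "(\<lambda>i. (i + a) mod N) ` {..<N} \<subseteq> {..<N}"
    by auto
  ultimately show ?thesis
    by (simp add: bij_betw_def endo_inj_surj)
qed

section \<open>The lexicographic product of the cycle with \<open>H\<close>, and walks in its coded
  form\<close>

definition lex_cycle_adj :: "nat \<Rightarrow> ('a, 'b) pre_digraph \<Rightarrow> nat \<times> 'a \<Rightarrow> nat \<times> 'a \<Rightarrow> bool" where
  "lex_cycle_adj N H x y \<longleftrightarrow>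
     fst x = fst y \<and> snd x \<rightarrow>\<^bsub>H\<^esub> snd y \<or> cyclic_adj N (fst x) (fst y)"

text \<open>A rotation of the cycle moves the fibre of \<open>x\<close> to that of \<open>y\<close>,
  and one automorphism of \<open>H\<close>, applied in every fibre alike, adjusts the second
  coordinate.\<close>

lemma lex_cycle_adj_transitive:
  assumes "vertex_transitive H" "x \<in> {..<N} \<times> verts H" "y \<in> {..<N} \<times> verts H"
  shows "\<exists>p. bij_betw p ({..<N} \<times> verts H) ({..<N} \<times> verts H) \<and> p x = y \<and>
    (\<forall>u\<in>{..<N} \<times> verts H. \<forall>v\<in>{..<N} \<times> verts H.
      lex_cycle_adj N H u v \<longleftrightarrow> lex_cycle_adj N H (p u) (p v))"
proof -
  obtain i h j k where x: "x = (i, h)" "i < N" "h \<in> verts H" and y: "y = (j, k)" "j < N" "k \<in> verts H"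
    using assms by auto
  obtain q where q: "bij_betw q (verts H) (verts H)" "q h = k"
    and adj: "\<And>u v. \<lbrakk>u \<in> verts H; v \<in> verts H\<rbrakk> \<Longrightarrow> u \<rightarrow>\<^bsub>H\<^esub> v \<longleftrightarrow> q u \<rightarrow>\<^bsub>H\<^esub> q v"
    using vertex_transitiveE[OF assms(1) x(3) y(3)] by metis
  \<comment> \<open>The shift sends \<open>i\<close> to \<open>N + j\<close>, which is
    \<open>j\<close> modulo \<open>N\<close>; writing \<open>N - i\<close> first keeps the
    subtraction exact.\<close>
  define r where "r l = (l + (N - i + j)) mod N" for l
  have "r i = j"
    using x(2) y(2) by (simp add: r_def)
  moreover have "r l = r l' \<longleftrightarrow> l = l'" if "l < N" "l' < N" for l l'
    using that mod_add_eq_cancel[of l "N - i + j" N l'] by (simp add: r_def)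
  moreover have "cyclic_adj N (r l) (r l') \<longleftrightarrow> cyclic_adj N l l'" if "l < N" "l' < N" for l l'
    unfolding r_def using that by (rule cyclic_adj_rotate)
  moreover have "bij_betw (map_prod r q) ({..<N} \<times> verts H) ({..<N} \<times> verts H)"
    unfolding r_def using bij_betw_rotate q(1) by (rule bij_betw_map_prod)
  ultimately show ?thesis
    using q(2) adj x y
    by (intro exI[of _ "map_prod r q"]) (auto simp: lex_cycle_adj_def)
qed

text \<open>With the rule that prepends an arc, this reduces an explicit list of arcs to one
  adjacency check per arc.\<close>

lemma coded_graph_awalk_1:
  assumes "x \<in> X" "y \<in> X" "A x y"
  shows "pre_digraph.awalk (coded_graph c X A) (c x) [(c x, c y)] (c y)"
proof -
  interpret wf_digraph "coded_graph c X A" by (rule wf_digraph_coded_graph)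
  show ?thesis using assms by (auto simp: awalk_simps)
qed

lemma coded_graph_awalk_Cons:
  assumes "x \<in> X" "y \<in> X" "A x y" "pre_digraph.awalk (coded_graph c X A) (c y) p v"
  shows "pre_digraph.awalk (coded_graph c X A) (c x) ((c x, c y) # p) v"
proof -
  interpret wf_digraph "coded_graph c X A" by (rule wf_digraph_coded_graph)
  show ?thesis using assms by (auto simp: awalk_simps)
qed

theorem theorem6:
  fixes H :: "('a, 'b) pre_digraph" and n :: nat
  assumes "graph H" and "verts H \<noteq> {}" and "vertex_transitive H" and "n \<ge> 1"
  shows "\<exists>(G :: (nat, nat \<times> nat) pre_digraph) R.
           graph G \<and> Digraph_Component.connected G \<and> vertex_transitive G \<and>
           graph_root G R \<and> card (verts R) = n \<and>
           digraph_iso H (distance_residual G R)"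
proof -
  interpret H: graph H by fact
  obtain h0 where h0: "h0 \<in> verts H"
    using assms(2) by blast
  \<comment> \<open>Outside the \<open>n\<close> root fibres there remain five, at cyclic distances
    1, 2, 3, 2, 1 from the arc. The middle one, \<open>n + 2\<close>, becomes \<open>L\<close>.
    Distance 3 is wanted because for \<open>n = 1\<close> a vertex in the fibre of the root can
    itself be at distance 2.\<close>
  define N where "N = n + 5"
  define X where "X = {..<N} \<times> verts H"
  define A where "A = lex_cycle_adj N H"
  have "finite X"
    by (simp add: X_def)
  \<comment> \<open>The vertices of \<open>H\<close> have an arbitrary type while those of
    \<open>G\<close> must be natural numbers; finiteness of \<open>X\<close> provides the
    coding.\<close>
  then obtain c :: "nat \<times> 'a \<Rightarrow> nat" where inj: "inj_on c X"
    using finite_imp_inj_to_nat_seg by metis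
  define G where "G = coded_graph c X A"
  define S where "S = {..<n} \<times> {h0}"
  define L where "L = {n + 2} \<times> verts H"
  define R where "R = G \<restriction> (c ` S)"
  have SX: "S \<subseteq> X" and LX: "L \<subseteq> X"
    using h0 by (auto simp: S_def L_def X_def N_def)
  have H_sym: "v \<rightarrow>\<^bsub>H\<^esub> u" if "u \<rightarrow>\<^bsub>H\<^esub> v" for u v
    using that H.sym_arcs by (auto simp: symmetric_def dest: symD)
  have H_irrefl: "\<not> u \<rightarrow>\<^bsub>H\<^esub> u" for u
    using H.adj_not_same by blast
  have A_sym: "A y x" if "A x y" for x y
    using that H_sym by (auto simp: A_def lex_cycle_adj_def cyclic_adj_sym)
  have A_irrefl: "\<not> A x x" if "x \<in> X" for x
    using that H_irrefl by (auto simp: A_def lex_cycle_adj_def X_def N_def cyclic_adj_iff)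
  have step: "A (i, h) (j, k)" if "cyclic_adj N i j" for i j h k
    using that by (simp add: A_def lex_cycle_adj_def)
  have "graph G"
    unfolding G_def using \<open>finite X\<close> inj A_sym A_irrefl by (intro graph_coded_graph) auto
  then interpret G: graph G .
  have G_adj: "c x \<rightarrow>\<^bsub>G\<^esub> c y" if "x \<in> X" "y \<in> X" "A x y" for x y
    unfolding G_def using that by (rule coded_graph_adj)

  have vt: "vertex_transitive G"
    unfolding G_def
  proof (rule vertex_transitive_coded_graph[OF inj])
    fix x y assume "x \<in> X" "y \<in> X"
    then show "\<exists>p. bij_betw p X X \<and> p x = y \<and> (\<forall>u\<in>X. \<forall>v\<in>X. A u v = A (p u) (p v))"
      unfolding X_def A_def by (rule lex_cycle_adj_transitive[OF assms(3)])
  qed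

  \<comment> \<open>Connectedness\<close>
  have in_X: "(i, h) \<in> X" if "i < N" "h \<in> verts H" for i h
    using that by (simp add: X_def)
  have reach0: "c (0, h0) \<rightarrow>\<^sup>*\<^bsub>G\<^esub> c (i, h0)" if "i < N" for i
    using that
  proof (induct i)
    case 0
    then show ?case using h0 by (intro G.reachable_refl) (auto simp: G_def X_def)
  next
    case (Suc i)
    then have "c (i, h0) \<rightarrow>\<^bsub>G\<^esub> c (Suc i, h0)"
      using h0 by (intro G_adj in_X step) (auto simp: cyclic_adj_iff)
    then show ?case
      using Suc by (auto intro: G.reachable_adj_trans)
  qed
  have reach: "c (0, h0) \<rightarrow>\<^sup>*\<^bsub>G\<^esub> v" if v: "v \<in> verts G" for v
  proof -
    obtain i h where ih: "v = c (i, h)" "i < N" "h \<in> verts H"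
      using v by (auto simp: G_def X_def)
    \<comment> \<open>The last step enters from a neighbouring fibre, as \<open>H\<close> may be
      disconnected and \<open>(i, h)\<close> unreachable from \<open>(i, h0)\<close> within its own
      fibre.\<close>
    define j where "j = (i + 1) mod N"
    have j: "j < N" "cyclic_adj N j i"
      by (auto simp: j_def N_def cyclic_adj_def)
    then have "c (j, h0) \<rightarrow>\<^bsub>G\<^esub> v"
      unfolding ih(1) using ih h0 by (intro G_adj in_X step) auto
    then show ?thesis
      by (rule G.reachable_adj_trans[OF reach0[OF j(1)]])
  qed
  have "u \<rightarrow>\<^sup>*\<^bsub>G\<^esub> v" if "u \<in> verts G" "v \<in> verts G" for u v
    using that by (intro G.reachable_trans[OF G.symmetric_reachable'[OF reach] reach])
  moreover have "verts G \<noteq> {}"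
    using in_X[of 0 h0] h0 by (auto simp: G_def N_def)
  \<comment> \<open>Connectedness refers to the symmetric closure, whose reachability agrees with
    that of \<open>G\<close> because \<open>G\<close> is symmetric.\<close>
  ultimately have conn: "Digraph_Component.connected G"
    unfolding connected_def strongly_connected_def
    using G.reachable_mk_symmetric_eq[OF G.sym_arcs] by simp

  \<comment> \<open>The root and its size\<close>
  have vR: "verts R = c ` S"
    by (simp add: R_def)
  have root: "graph_root G R"
    unfolding graph_root_def
  proof
    show "induced_subgraph R G"
      unfolding R_def using SX by (intro G.induced_induce) (auto simp: G_def)
    show "verts R \<noteq> {}"
      using assms(4) by (auto simp: vR S_def lessThan_empty_iff)
  qed
  have "card (c ` S) = card S"
    using inj SX by (intro card_image) (rule inj_on_subset)
  then have cardR: "card (verts R) = n"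
    by (simp add: vR S_def)

  \<comment> \<open>Lower bounds on the distance from the root, by a potential\<close>
  define pot where "pot v = arc_dist n (fst (inv_into X c v))" for v
  have pot: "pot (c (i, h)) = arc_dist n i" if "(i, h) \<in> X" for i h
    using inj that by (simp add: pot_def)
  have lower: "ereal (real (pot v)) \<le> graph_set_dist G (verts R) v" for v
  proof (rule G.graph_set_dist_ge_potential)
    fix u assume "u \<in> verts R"
    then obtain i where i: "i < n" "u = c (i, h0)"
      by (auto simp: vR S_def)
    then have "pot u = arc_dist n i"
      using pot[of i h0] SX by (auto simp: S_def)
    then show "pot u = 0"
      using i(1) by (simp add: arc_dist_def)
  next
    fix a assume "a \<in> arcs G"
    then obtain i h j k where a: "a = (c (i, h), c (j, k))"
      and X: "(i, h) \<in> X" "(j, k) \<in> X" and "A (i, h) (j, k)"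
      by (auto simp: G_def)
    \<comment> \<open>The potential sees only the fibre: arcs inside a fibre leave it unchanged, and
      the others follow edges of the cycle.\<close>
    then have "i = j \<or> cyclic_adj N i j"
      by (auto simp: A_def lex_cycle_adj_def)
    moreover have "i < n + 5" "j < n + 5"
      using X by (auto simp: X_def N_def)
    ultimately have "arc_dist n j \<le> arc_dist n i + 1"
      using arc_dist_le[OF _ _ assms(4)] unfolding N_def by auto
    then show "pot (head G a) \<le> pot (tail G a) + 1"
      using X by (simp add: a G_def pot)
  qed

  \<comment> \<open>Upper bounds on the distance from the root, by explicit walks\<close>
  note walk = coded_graph_awalk_1[where c=c and X=X and A=A, folded G_def]
    coded_graph_awalk_Cons[where c=c and X=X and A=A, folded G_def]
  have S: "c (i, h0) \<in> verts R" if "i < n" for i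
    using that by (simp add: vR S_def)
  have dist1: "graph_set_dist G (verts R) (c (j, h)) \<le> 1"
    if "cyclic_adj N i j" "i < n" "j < N" "h \<in> verts H" for i j h
  proof -
    have "G.awalk (c (i, h0)) [(c (i, h0), c (j, h))] (c (j, h))"
      using that h0 by (intro walk in_X step) (auto simp: N_def)
    from G.graph_set_dist_le_length[OF this S] show ?thesis
      using that by (simp add: one_ereal_def)
  qed
  have dist2: "graph_set_dist G (verts R) (c (k, h)) \<le> 2"
    if "cyclic_adj N i j" "cyclic_adj N j k" "i < n" "j < N" "k < N" "h \<in> verts H" for i j k h
  proof -
    \<comment> \<open>The walk runs along the \<open>h0\<close> vertices and reaches
      \<open>h\<close> only with its last arc. Every arc changes fibre, so nothing about the
      adjacency of \<open>H\<close> is required.\<close>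
    have "G.awalk (c (i, h0)) [(c (i, h0), c (j, h0)), (c (j, h0), c (k, h))] (c (k, h))"
      using that h0 by (intro walk in_X step) (auto simp: N_def)
    from G.graph_set_dist_le_length[OF this S] show ?thesis
      using that by simp
  qed
  have dist3: "graph_set_dist G (verts R) (c (n + 2, h)) \<le> 3" if "h \<in> verts H" for h
  proof -
    have "G.awalk (c (n - 1, h0)) [(c (n - 1, h0), c (n, h0)), (c (n, h0), c (n + 1, h0)),
        (c (n + 1, h0), c (n + 2, h))] (c (n + 2, h))"
      using that h0 assms(4) by (intro walk in_X step) (auto simp: N_def cyclic_adj_iff)
    from G.graph_set_dist_le_length[OF this S] show ?thesis
      using assms(4) by simp
  qed
  have near: "graph_set_dist G (verts R) (c (i, h)) \<le> 2"
    if i: "i < N" "i \<noteq> n + 2" and "h \<in> verts H" for i h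
  proof -
    consider "i < n" | "i = n" | "i = n + 1" | "i = n + 3" | "i = n + 4"
      using i unfolding N_def by linarith
    then show ?thesis
    proof cases
      case 1
      then show ?thesis
        \<comment> \<open>A vertex in a root fibre is reached by going out to the next fibre and
          back.\<close>
        using that assms(4) by (intro dist2[of i "Suc i"]) (auto simp: N_def cyclic_adj_iff)
    next
      case 2
      then have "graph_set_dist G (verts R) (c (i, h)) \<le> 1"
        using that assms(4) by (intro dist1[of "n - 1"]) (auto simp: N_def cyclic_adj_iff)
      then show ?thesis by (rule order_trans) simp
    next
      case 3
      then show ?thesis
        using that assms(4) by (intro dist2[of "n - 1" n]) (auto simp: N_def cyclic_adj_iff)
    next
      case 4
      then show ?thesis
        \<comment> \<open>The fibres \<open>n + 3\<close> and \<open>n + 4\<close> are approached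
          from the other end of the arc, through the closing edge at 0.\<close>
        using that assms(4) by (intro dist2[of 0 "n + 4"]) (auto simp: N_def cyclic_adj_iff)
    next
      case 5
      then have "graph_set_dist G (verts R) (c (i, h)) \<le> 1"
        using that assms(4) by (intro dist1[of 0]) (auto simp: N_def cyclic_adj_iff)
      then show ?thesis by (rule order_trans) simp
    qed
  qed
  have far: "graph_set_dist G (verts R) (c (n + 2, h)) = 3" if "h \<in> verts H" for h
  proof (rule antisym)
    have "pot (c (n + 2, h)) = arc_dist n (n + 2)"
      using that by (intro pot in_X) (auto simp: N_def)
    \<comment> \<open>Both terms of the minimum equal 3 here, as \<open>n + 2\<close> lies opposite
      the arc.\<close>
    then have "pot (c (n + 2, h)) = 3"
      by (simp add: arc_dist_def)
    then show "3 \<le> graph_set_dist G (verts R) (c (n + 2, h))"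
      using lower[of "c (n + 2, h)"] by simp
  qed (rule dist3[OF that])

  \<comment> \<open>The last layer is the opposite fibre, a copy of \<open>H\<close>\<close>
  have "distance_residual G R = G \<restriction> (c ` L)"
  proof (rule distance_residual_eq)
    have "v \<in> c ` L" if v: "v \<in> verts G" "graph_set_dist G (verts R) v = 3" for v
    proof -
      obtain i h where ih: "v = c (i, h)" "i < N" "h \<in> verts H"
        using v(1) by (auto simp: G_def X_def)
      have "i = n + 2"
      proof (rule ccontr)
        assume "i \<noteq> n + 2"
        then have "(3 :: ereal) \<le> 2"
          using near[OF ih(2) _ ih(3)] v(2) ih(1) by simp
        then show False by simp
      qed
      then show ?thesis
        using ih by (simp add: L_def)
    qed
    moreover have "c ` L \<subseteq> verts G"
      using LX by (auto simp: G_def)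
    ultimately show "dist_layer G (verts R) 3 = c ` L"
      using far by (auto simp: dist_layer_def L_def)
    show "c ` L \<noteq> {}"
      using h0 by (auto simp: L_def)
    fix v assume "v \<in> verts G"
    then obtain i h where ih: "v = c (i, h)" "i < N" "h \<in> verts H"
      by (auto simp: G_def X_def)
    have "(2 :: ereal) \<le> 3" by simp
    then have "graph_set_dist G (verts R) v \<le> 3"
      using near[OF ih(2) _ ih(3)] far[OF ih(3)] ih(1) by (cases "i = n + 2") (auto intro: order_trans)
    then show "graph_set_dist G (verts R) v \<le> ereal (real 3)"
      by simp
  qed
  also have "\<dots> = coded_graph c L A"
    unfolding G_def using inj LX by (rule coded_graph_induce)
  finally have res: "distance_residual G R = coded_graph c L A" .
  have "digraph_iso H (coded_graph c L A)"
  proof (rule digraph_iso_coded_graph[where p = "\<lambda>h. (n + 2, h)"])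
    show "nomulti_digraph H" by unfold_locales
    show "inj_on c L" using inj LX by (rule inj_on_subset)
    show "bij_betw (\<lambda>h. (n + 2, h)) (verts H) L"
      by (auto simp: bij_betw_def inj_on_def L_def)
  \<comment> \<open>Since \<open>n + 2\<close> is not cyclically adjacent to itself, adjacency
    within this fibre is exactly that of \<open>H\<close>.\<close>
  qed (auto simp: A_def lex_cycle_adj_def N_def cyclic_adj_iff)
  then have "digraph_iso H (distance_residual G R)"
    by (simp only: res)
  then show ?thesis
    using \<open>graph G\<close> conn vt root cardR by (intro exI[of _ G] exI[of _ R] conjI)
qed

end
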